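(* Let $(E,d_E)$ be a complete separable metric space with Borel $\sigma$-algebra $\mathcal E$ that is bounded, i.e. $\sup_{x,y\in E}d_E(x,y)\le D<\infty$. Let $\Phi\colon E\to[0,\infty)$ be measurable such that $e^{-\Phi}\colon E\to[0,1]$ is Lipschitz with respect to $d_E$, i.e. $\mathrm{Lip}(e^{-\Phi})<\infty$. Let $\mu,\widetilde\mu$ be probability measures on $(E,\mathcal E)$, put $Z:=\int_E e^{-\Phi}\,d\mu$, $\widetilde Z:=\int_E e^{-\Phi}\,d\widetilde\mu$, and define the probability measures $$\mu_\Phi(dx):=\frac1Z e^{-\Phi(x)}\,\mu(dx),\qquad \widetilde\mu_\Phi(dx):=\frac1{\widetilde Z}e^{-\Phi(x)}\,\widetilde\mu(dx).$$ Then $$\mathrm W_1(\mu_\Phi,\widetilde\mu_\Phi)\le\frac{1+D\,\mathrm{Lip}(e^{-\Phi})}{\widetilde Z}\left(1+\mathrm{Lip}(e^{-\Phi})\,\frac{|\mu|_{\mathcal P^1}}{Z}\right)\mathrm W_1(\mu,\widetilde\mu)$$ and $$|Z-\widetilde Z|\le\mathrm{Lip}(e^{-\Phi})\,\mathrm W_1(\mu,\widetilde\mu).$$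
   Context: $\mathrm{Lip}(f):=\sup_{x\ne y}\frac{|f(x)-f(y)|}{d_E(x,y)}$ is the global Lipschitz constant. $|\mu|_{\mathcal P^1}:=\inf_{x_0\in E}\int_E d_E(x,x_0)\,\mu(dx)$. The 1-Wasserstein distance is $\mathrm W_1(\mu,\widetilde\mu):=\inf_{\pi\in\Pi(\mu,\widetilde\mu)}\int_{E\times E}d_E(x,y)\,\pi(dx\,dy)$, where $\Pi(\mu,\widetilde\mu)$ is the set of couplings of $\mu$ and $\widetilde\mu$. *)

theory Defs
  imports "HOL-Probability.Probability"
begin

text \<open>
  Suprema, infima and integrals that may be infinite are taken in \<^typ>\<open>ennreal\<close>.  In particular
  the supremum over the empty index set is 0, so every function on a one-point space has
  Lipschitz constant 0.
\<close>

definition Lip :: "('a::metric_space \<Rightarrow> real) \<Rightarrow> ennreal" where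
  "Lip f = (SUP (x, y) \<in> {(x, y). x \<noteq> y}. ennreal (\<bar>f x - f y\<bar> / dist x y))"

definition first_moment :: "'a::metric_space measure \<Rightarrow> ennreal" where
  "first_moment \<mu> = (INF x0. \<integral>\<^sup>+ x. ennreal (dist x x0) \<partial>\<mu>)"

definition couplings :: "'a measure \<Rightarrow> 'b measure \<Rightarrow> ('a \<times> 'b) measure set" where
  "couplings \<mu> \<nu> = {\<pi>. prob_space \<pi> \<and> sets \<pi> = sets (\<mu> \<Otimes>\<^sub>M \<nu>) \<and>
     distr \<pi> \<mu> fst = \<mu> \<and> distr \<pi> \<nu> snd = \<nu>}"

definition W1 :: "'a::metric_space measure \<Rightarrow> 'a measure \<Rightarrow> ennreal" where
  "W1 \<mu> \<nu> = (INF \<pi> \<in> couplings \<mu> \<nu>. \<integral>\<^sup>+ (x, y). ennreal (dist x y) \<partial>\<pi>)"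

definition norm_const :: "('a \<Rightarrow> real) \<Rightarrow> 'a measure \<Rightarrow> real" where
  "norm_const \<Phi> \<mu> = (\<integral> x. exp (- \<Phi> x) \<partial>\<mu>)"

definition posterior :: "('a \<Rightarrow> real) \<Rightarrow> 'a measure \<Rightarrow> 'a measure" where
  "posterior \<Phi> \<mu> = density \<mu> (\<lambda>x. ennreal (exp (- \<Phi> x) / norm_const \<Phi> \<mu>))"

text \<open>
  The normalising constant is positive and the reweighted measure is a probability measure,
  so the divisions by the normalising constant are never degenerate.
\<close>

lemma integrable_exp_neg:
  assumes "prob_space \<mu>" and "\<Phi> \<in> borel_measurable \<mu>" and "\<And>x. 0 \<le> \<Phi> x"
  shows "integrable \<mu> (\<lambda>x. exp (- \<Phi> x) :: real)"
proof -
  interpret prob_space \<mu> by fact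
  show ?thesis
    by (rule integrable_const_bound[where B = 1]) (use assms in auto)
qed

lemma norm_const_pos:
  assumes "prob_space \<mu>" and "\<Phi> \<in> borel_measurable \<mu>" and "\<And>x. 0 \<le> \<Phi> x"
  shows "0 < norm_const \<Phi> \<mu>"
proof -
  interpret prob_space \<mu> by fact
  have "norm_const \<Phi> \<mu> \<noteq> 0"
  proof
    assume "norm_const \<Phi> \<mu> = 0"
    then have "AE x in \<mu>. exp (- \<Phi> x) = 0"
      unfolding norm_const_def
      by (subst (asm) integral_nonneg_eq_0_iff_AE) (use integrable_exp_neg[OF assms] in auto)
    then show False by simp
  qed
  moreover have "0 \<le> norm_const \<Phi> \<mu>"
    unfolding norm_const_def by simp
  ultimately show ?thesis by simp
qed

lemma prob_space_posterior:
  assumes "prob_space \<mu>" and "\<Phi> \<in> borel_measurable \<mu>" and "\<And>x. 0 \<le> \<Phi> x"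
  shows "prob_space (posterior \<Phi> \<mu>)"
proof (rule prob_spaceI)
  note pos = norm_const_pos[OF assms]
  note [measurable] = assms(2)
  have "emeasure (posterior \<Phi> \<mu>) (space (posterior \<Phi> \<mu>))
      = (\<integral>\<^sup>+ x. ennreal (exp (- \<Phi> x) / norm_const \<Phi> \<mu>) \<partial>\<mu>)"
    unfolding posterior_def
    by (auto simp: emeasure_density intro!: nn_integral_cong)
  also have "\<dots> = ennreal (\<integral> x. exp (- \<Phi> x) / norm_const \<Phi> \<mu> \<partial>\<mu>)"
    by (rule nn_integral_eq_integral) (use integrable_exp_neg[OF assms] pos in auto)
  also have "\<dots> = 1"
    using pos by (simp add: norm_const_def)
  finally show "emeasure (posterior \<Phi> \<mu>) (space (posterior \<Phi> \<mu>)) = 1" .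
qed

end

theory Submission
  imports Defs
begin

text \<open>
  A coupling of the two posteriors is built directly from a coupling \<open>\<pi>\<close> of \<open>\<mu>\<close> and \<open>\<mu>'\<close>, without
  Kantorovich duality.  With \<open>g = exp (- \<Phi>)\<close> and \<open>M = max Z Z'\<close>, the measure with density
  \<open>w (x, y) = min (g x) (g y) / M\<close> with respect to \<open>\<pi>\<close> has marginals below the posteriors and
  transport cost at most \<open>W / M\<close>, where \<open>W\<close> is the cost of \<open>\<pi>\<close>.  As \<open>min (g x) (g y)\<close> exceeds both
  \<open>g x - L d(x, y)\<close> and \<open>g y - L d(x, y)\<close>, the missing mass is at most \<open>L W / M\<close>, and moving it
  costs at most \<open>D L W / M\<close>.  This gives the bound with the factor \<open>(1 + D L) / Z'\<close> alone; the factor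
  involving the first moment is at least 1.
\<close>

section \<open>Infima in \<open>ennreal\<close>, Lipschitz bounds and the product coupling\<close>

text \<open>Dividing by \<open>c\<close> turns a bound for every index into a lower bound of the
  infimum; estimates for a fixed coupling become estimates with \<open>W1\<close> in this way.
  Nonemptiness matters for \<open>c = 0\<close>, since the empty infimum is \<open>\<top>\<close>
  and \<open>0 * \<top> = 0\<close>; for \<open>c = \<top>\<close> an infimum 0 that is not attained
  would break the claim.\<close>

lemma ennreal_le_cmult_INF:
  fixes f :: "'i \<Rightarrow> ennreal"
  assumes "I \<noteq> {}" and "c \<noteq> \<top>" and le: "\<And>i. i \<in> I \<Longrightarrow> x \<le> c * f i"
  shows "x \<le> c * (INF i\<in>I. f i)"
proof (cases "c = 0")
  case True
  with assms show ?thesis by fastforce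
next
  case False
  then have c: "0 < c" by (simp add: zero_less_iff_neq_zero)
  have "x / c \<le> (INF i\<in>I. f i)"
    by (intro INF_greatest divide_le_posI_ennreal c) (use le in \<open>simp add: mult.commute\<close>)
  then have "c * (x / c) \<le> c * (INF i\<in>I. f i)"
    by (rule mult_left_mono) simp
  also have "c * (x / c) = x"
    using False assms(2) by (simp add: ennreal_times_divide mult.commute[of c] ennreal_mult_divide_eq)
  finally show ?thesis .
qed

lemma abs_diff_le_Lip:
  assumes "Lip f < \<infinity>"
  shows "\<bar>f x - f y\<bar> \<le> enn2real (Lip f) * dist x y"
proof (cases "x = y")
  case False
  then have "ennreal (\<bar>f x - f y\<bar> / dist x y) \<le> Lip f"
    unfolding Lip_def by (intro SUP_upper2[of "(x, y)"]) auto
  then have "\<bar>f x - f y\<bar> / dist x y \<le> enn2real (Lip f)"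
    using assms by (metis enn2real_nonneg ennreal_enn2real ennreal_le_iff infinity_ennreal_def)
  with False show ?thesis by (simp add: field_simps)
qed simp

text \<open>Supplies a nonempty index set for the infimum in \<open>W1\<close>. Swapping the factors
  reduces the second marginal to a first marginal.\<close>

lemma pair_measure_in_couplings:
  assumes "prob_space \<mu>" and "prob_space \<nu>"
  shows "\<mu> \<Otimes>\<^sub>M \<nu> \<in> couplings \<mu> \<nu>"
proof -
  interpret M: prob_space \<mu> by fact
  interpret N: prob_space \<nu> by fact
  interpret P: pair_prob_space \<mu> \<nu> ..
  have "distr (\<mu> \<Otimes>\<^sub>M \<nu>) \<nu> snd = distr (\<nu> \<Otimes>\<^sub>M \<mu>) \<nu> fst"
    by (subst P.distr_pair_swap) (simp add: distr_distr comp_def case_prod_beta)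
  then show ?thesis
    using P.prob_space_axioms
    by (simp add: couplings_def N.distr_pair_fst M.distr_pair_fst)
qed

section \<open>Reweighting the marginals of a coupling\<close>

text \<open>
  The part of \<open>\<pi>\<close> with density \<open>w\<close> is kept; the residual marginals
  \<open>(u - w) \<pi>\<close> and \<open>(v - w) \<pi>\<close>, which have equal mass, are coupled independently.
\<close>

lemma coupling_reweight:
  fixes \<mu> :: "'a measure" and \<nu> :: "'b measure"
  assumes pi: "\<pi> \<in> couplings \<mu> \<nu>"
    and u [measurable]: "u \<in> borel_measurable \<mu>" and v [measurable]: "v \<in> borel_measurable \<nu>"
    and w [measurable]: "w \<in> borel_measurable \<pi>"
    and wu: "\<And>z. w z \<le> u (fst z)" and wv: "\<And>z. w z \<le> v (snd z)"
    and u1: "(\<integral>\<^sup>+ x. u x \<partial>\<mu>) = 1" and v1: "(\<integral>\<^sup>+ y. v y \<partial>\<nu>) = 1"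
    and f [measurable]: "f \<in> borel_measurable \<pi>" and fD: "\<And>z. f z \<le> D"
  shows "\<exists>\<gamma> \<in> couplings (density \<mu> u) (density \<nu> v).
    (\<integral>\<^sup>+ z. f z \<partial>\<gamma>) \<le> (\<integral>\<^sup>+ z. w z * f z \<partial>\<pi>) + D * (1 - (\<integral>\<^sup>+ z. w z \<partial>\<pi>))"
proof -
  from pi have [measurable_cong]: "sets \<pi> = sets (\<mu> \<Otimes>\<^sub>M \<nu>)"
    and fst_pi: "distr \<pi> \<mu> fst = \<mu>" and snd_pi: "distr \<pi> \<nu> snd = \<nu>"
    and "prob_space \<pi>"
    by (auto simp: couplings_def)
  interpret P: prob_space \<pi> by fact
  interpret B: sigma_finite_measure "count_space (UNIV :: bool set)"
    by (rule sigma_finite_measure_count_space)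
  interpret PB: sigma_finite_measure "\<pi> \<Otimes>\<^sub>M count_space (UNIV :: bool set)"
    by (intro sigma_finite_pair_measure) unfold_locales
  \<comment> \<open>Subtraction in \<open>ennreal\<close> truncates at 0; since \<open>w\<close>
    lies below both densities, \<open>w + a\<close> and \<open>w + b\<close> still recover
    \<open>u\<close> and \<open>v\<close>.\<close>
  define a where "a z = u (fst z) - w z" for z
  define b where "b z = v (snd z) - w z" for z
  define R where "R = (\<integral>\<^sup>+ z. a z \<partial>\<pi>)"
  have a_meas [measurable]: "a \<in> borel_measurable \<pi>" and b_meas [measurable]: "b \<in> borel_measurable \<pi>"
    unfolding a_def b_def by measurable
  have wa: "w z + a z = u (fst z)" and wb: "w z + b z = v (snd z)" for z
    using wu[of z] wv[of z] by (simp_all add: a_def b_def add.commute diff_add_cancel_ennreal)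
  have int_fst: "(\<integral>\<^sup>+ z. k (fst z) \<partial>\<pi>) = (\<integral>\<^sup>+ x. k x \<partial>\<mu>)"
    if [measurable]: "k \<in> borel_measurable \<mu>" for k
    by (subst fst_pi[symmetric], subst nn_integral_distr) simp_all
  have int_snd: "(\<integral>\<^sup>+ z. k (snd z) \<partial>\<pi>) = (\<integral>\<^sup>+ x. k x \<partial>\<nu>)"
    if [measurable]: "k \<in> borel_measurable \<nu>" for k
    by (subst snd_pi[symmetric], subst nn_integral_distr) simp_all
  have wR: "(\<integral>\<^sup>+ z. w z \<partial>\<pi>) + R = 1"
    unfolding R_def by (subst nn_integral_add[symmetric]) (simp_all add: wa int_fst u1)
  have wRb: "(\<integral>\<^sup>+ z. w z \<partial>\<pi>) + (\<integral>\<^sup>+ z. b z \<partial>\<pi>) = 1"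
    by (subst nn_integral_add[symmetric]) (simp_all add: wb int_snd v1)
  have w_fin: "(\<integral>\<^sup>+ z. w z \<partial>\<pi>) \<noteq> \<top>" and R_fin: "R \<noteq> \<top>"
    using wR by auto
  then have R_R: "R / R = 1" if "R \<noteq> 0"
    using that by (simp add: less_top[symmetric])
  \<comment> \<open>Both residuals complete the mass of \<open>w\<close> to 1, and that mass is
    finite, so it cancels.\<close>
  have Rb: "(\<integral>\<^sup>+ z. b z \<partial>\<pi>) = R"
    using wR wRb w_fin by (metis ennreal_add_diff_cancel_left)
  have R_eq: "R = 1 - (\<integral>\<^sup>+ z. w z \<partial>\<pi>)"
    using wR w_fin by (metis ennreal_add_diff_cancel_left)

  \<comment> \<open>One push-forward yields both parts of \<open>\<gamma>\<close>, selected by the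
    Boolean \<open>c\<close>. If \<open>c\<close> holds, \<open>p\<close> is kept with weight
    \<open>w p\<close> and \<open>q\<close> is a dummy; otherwise the first component of
    \<open>p\<close> is paired with the second component of an independent \<open>q\<close>, with
    weight \<open>a p * b q / R\<close>. Dividing by the common mass \<open>R\<close> gives this
    product the right marginals.\<close>
  define h where "h = (\<lambda>(p, q, c). if c then w p else a p * b q / R)"
  define T where "T = (\<lambda>(p :: 'a \<times> 'b, q :: 'a \<times> 'b, c). if c then p else (fst p, snd q))"
  define J where "J = density (\<pi> \<Otimes>\<^sub>M \<pi> \<Otimes>\<^sub>M count_space (UNIV :: bool set)) h"
  define \<gamma> where "\<gamma> = distr J (density \<mu> u \<Otimes>\<^sub>M density \<nu> v) T"
  have h_meas [measurable]: "h \<in> borel_measurable (\<pi> \<Otimes>\<^sub>M \<pi> \<Otimes>\<^sub>M count_space (UNIV :: bool set))"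
    unfolding h_def by measurable
  have T_meas [measurable]: "T \<in> \<pi> \<Otimes>\<^sub>M \<pi> \<Otimes>\<^sub>M count_space (UNIV :: bool set) \<rightarrow>\<^sub>M \<mu> \<Otimes>\<^sub>M \<nu>"
    unfolding T_def by measurable
  have sets_N: "sets (density \<mu> u \<Otimes>\<^sub>M density \<nu> v) = sets (\<mu> \<Otimes>\<^sub>M \<nu>)"
    by (intro sets_pair_measure_cong) auto
  have sets_g [measurable_cong]: "sets \<gamma> = sets (\<mu> \<Otimes>\<^sub>M \<nu>)"
    by (simp add: \<gamma>_def sets_N)
  \<comment> \<open>Summing over \<open>c\<close> separates the kept part from the independently
    paired part; the dummy \<open>q\<close> integrates to 1. Marginals, total mass and cost of
    \<open>\<gamma>\<close> all follow by choosing \<open>k\<close>.\<close>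
  have int_g: "(\<integral>\<^sup>+ z. k z \<partial>\<gamma>)
      = (\<integral>\<^sup>+ p. w p * k p \<partial>\<pi>) + (\<integral>\<^sup>+ p. \<integral>\<^sup>+ q. a p * b q / R * k (fst p, snd q) \<partial>\<pi> \<partial>\<pi>)"
    if k [measurable]: "k \<in> borel_measurable (\<mu> \<Otimes>\<^sub>M \<nu>)" for k
  proof -
    have T': "T \<in> J \<rightarrow>\<^sub>M density \<mu> u \<Otimes>\<^sub>M density \<nu> v"
      using T_meas unfolding J_def
      by (simp add: measurable_density_eq1 measurable_cong_sets[OF refl sets_N])
    have "(\<integral>\<^sup>+ z. k z \<partial>\<gamma>) = (\<integral>\<^sup>+ t. k (T t) \<partial>J)"
      unfolding \<gamma>_def by (rule nn_integral_distr[OF T'])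
        (simp add: measurable_cong_sets[OF sets_N refl])
    also have "\<dots> = (\<integral>\<^sup>+ t. h t * k (T t) \<partial>(\<pi> \<Otimes>\<^sub>M \<pi> \<Otimes>\<^sub>M count_space (UNIV :: bool set)))"
      unfolding J_def by (rule nn_integral_density) measurable
    also have "\<dots> = (\<integral>\<^sup>+ p. \<integral>\<^sup>+ q. \<integral>\<^sup>+ c. h (p, q, c) * k (T (p, q, c)) \<partial>count_space UNIV \<partial>\<pi> \<partial>\<pi>)"
      by (subst PB.nn_integral_fst[symmetric], measurable)
        (intro nn_integral_cong, subst B.nn_integral_fst[symmetric], auto)
    also have "\<dots> = (\<integral>\<^sup>+ p. \<integral>\<^sup>+ q. w p * k p + a p * b q / R * k (fst p, snd q) \<partial>\<pi> \<partial>\<pi>)"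
      by (simp add: nn_integral_count_space_finite UNIV_bool h_def T_def add.commute)
    also have "\<dots> = (\<integral>\<^sup>+ p. w p * k p + (\<integral>\<^sup>+ q. a p * b q / R * k (fst p, snd q) \<partial>\<pi>) \<partial>\<pi>)"
    proof (intro nn_integral_cong)
      fix p assume p: "p \<in> space \<pi>"
      then have "fst p \<in> space \<mu>"
        by (rule measurable_space[rotated]) measurable
      then have "(\<lambda>q. a p * b q / R * k (fst p, snd q)) \<in> borel_measurable \<pi>"
        by measurable
      then show "(\<integral>\<^sup>+ q. w p * k p + a p * b q / R * k (fst p, snd q) \<partial>\<pi>)
          = w p * k p + (\<integral>\<^sup>+ q. a p * b q / R * k (fst p, snd q) \<partial>\<pi>)"
        by (simp add: nn_integral_add P.emeasure_space_1)
    qed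
    also have "\<dots> = (\<integral>\<^sup>+ p. w p * k p \<partial>\<pi>) + (\<integral>\<^sup>+ p. \<integral>\<^sup>+ q. a p * b q / R * k (fst p, snd q) \<partial>\<pi> \<partial>\<pi>)"
      by (rule nn_integral_add) measurable
    finally show ?thesis .
  qed
  text \<open>If \<open>R = 0\<close> then \<open>a\<close> and \<open>b\<close> vanish almost everywhere.\<close>
  have a_R: "(\<integral>\<^sup>+ p. a p * k p * (R / R) \<partial>\<pi>) = (\<integral>\<^sup>+ p. a p * k p \<partial>\<pi>)"
    if [measurable]: "k \<in> borel_measurable \<pi>" for k
  proof (cases "R = 0")
    case True
    then have "AE p in \<pi>. a p = 0" by (simp add: R_def nn_integral_0_iff_AE)
    then show ?thesis by (intro nn_integral_cong_AE) auto
  qed (simp add: R_R)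
  have b_R: "(\<integral>\<^sup>+ p. b p * k p * (R / R) \<partial>\<pi>) = (\<integral>\<^sup>+ p. b p * k p \<partial>\<pi>)"
    if [measurable]: "k \<in> borel_measurable \<pi>" for k
  proof (cases "R = 0")
    case True
    then have "AE p in \<pi>. b p = 0" using Rb by (simp add: nn_integral_0_iff_AE)
    then show ?thesis by (intro nn_integral_cong_AE) auto
  qed (simp add: R_R)
  \<comment> \<open>Integrating out \<open>q\<close> leaves \<open>a\<close> times
    \<open>R / R\<close> in the paired part, and \<open>w + a\<close> is the density
    \<open>u\<close>.\<close>
  have g_fst: "(\<integral>\<^sup>+ z. k (fst z) \<partial>\<gamma>) = (\<integral>\<^sup>+ x. u x * k x \<partial>\<mu>)"
    if [measurable]: "k \<in> borel_measurable \<mu>" for k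
  proof -
    have "(\<integral>\<^sup>+ p. \<integral>\<^sup>+ q. a p * b q / R * k (fst p) \<partial>\<pi> \<partial>\<pi>) = (\<integral>\<^sup>+ p. \<integral>\<^sup>+ q. (a p * k (fst p) / R) * b q \<partial>\<pi> \<partial>\<pi>)"
      by (intro nn_integral_cong) (simp add: divide_ennreal_def mult_ac)
    also have "\<dots> = (\<integral>\<^sup>+ p. a p * k (fst p) * (R / R) \<partial>\<pi>)"
      by (subst nn_integral_cmult) (auto simp: Rb divide_ennreal_def mult_ac)
    also have "\<dots> = (\<integral>\<^sup>+ p. a p * k (fst p) \<partial>\<pi>)"
      by (rule a_R) measurable
    finally have "(\<integral>\<^sup>+ z. k (fst z) \<partial>\<gamma>) = (\<integral>\<^sup>+ p. w p * k (fst p) \<partial>\<pi>) + (\<integral>\<^sup>+ p. a p * k (fst p) \<partial>\<pi>)"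
      by (subst int_g) auto
    also have "\<dots> = (\<integral>\<^sup>+ p. u (fst p) * k (fst p) \<partial>\<pi>)"
      by (subst nn_integral_add[symmetric]) (auto simp: wa simp flip: distrib_right)
    also have "\<dots> = (\<integral>\<^sup>+ x. u x * k x \<partial>\<mu>)"
      by (rule int_fst) measurable
    finally show ?thesis .
  qed
  have g_snd: "(\<integral>\<^sup>+ z. k (snd z) \<partial>\<gamma>) = (\<integral>\<^sup>+ x. v x * k x \<partial>\<nu>)"
    if [measurable]: "k \<in> borel_measurable \<nu>" for k
  proof -
    have "(\<integral>\<^sup>+ p. \<integral>\<^sup>+ q. a p * b q / R * k (snd q) \<partial>\<pi> \<partial>\<pi>)
        = (\<integral>\<^sup>+ p. \<integral>\<^sup>+ q. a p * (b q * k (snd q) / R) \<partial>\<pi> \<partial>\<pi>)"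
      by (intro nn_integral_cong) (simp add: divide_ennreal_def mult_ac)
    also have "\<dots> = R * (\<integral>\<^sup>+ q. b q * k (snd q) / R \<partial>\<pi>)"
      by (simp add: nn_integral_cmult nn_integral_multc R_def)
    also have "\<dots> = (\<integral>\<^sup>+ q. b q * k (snd q) * (R / R) \<partial>\<pi>)"
      by (subst nn_integral_cmult[symmetric]) (auto simp: divide_ennreal_def mult_ac)
    also have "\<dots> = (\<integral>\<^sup>+ p. b p * k (snd p) \<partial>\<pi>)"
      by (rule b_R) measurable
    finally have "(\<integral>\<^sup>+ z. k (snd z) \<partial>\<gamma>) = (\<integral>\<^sup>+ p. w p * k (snd p) \<partial>\<pi>) + (\<integral>\<^sup>+ p. b p * k (snd p) \<partial>\<pi>)"
      by (subst int_g) auto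
    also have "\<dots> = (\<integral>\<^sup>+ p. v (snd p) * k (snd p) \<partial>\<pi>)"
      by (subst nn_integral_add[symmetric]) (auto simp: wb simp flip: distrib_right)
    also have "\<dots> = (\<integral>\<^sup>+ x. v x * k x \<partial>\<nu>)"
      by (rule int_snd) measurable
    finally show ?thesis .
  qed
  have "distr \<gamma> (density \<mu> u) fst = density \<mu> u"
  proof (rule measure_eqI)
    fix A assume "A \<in> sets (distr \<gamma> (density \<mu> u) fst)"
    then have [measurable]: "A \<in> sets \<mu>" by simp
    have "emeasure (distr \<gamma> (density \<mu> u) fst) A = (\<integral>\<^sup>+ z. indicator A (fst z) \<partial>\<gamma>)"
      by (subst nn_integral_indicator[symmetric], simp, subst nn_integral_distr) simp_all
    then show "emeasure (distr \<gamma> (density \<mu> u) fst) A = emeasure (density \<mu> u) A"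
      by (simp add: g_fst emeasure_density)
  qed simp
  moreover have "distr \<gamma> (density \<nu> v) snd = density \<nu> v"
  proof (rule measure_eqI)
    fix A assume "A \<in> sets (distr \<gamma> (density \<nu> v) snd)"
    then have [measurable]: "A \<in> sets \<nu>" by simp
    have "emeasure (distr \<gamma> (density \<nu> v) snd) A = (\<integral>\<^sup>+ z. indicator A (snd z) \<partial>\<gamma>)"
      by (subst nn_integral_indicator[symmetric], simp, subst nn_integral_distr) simp_all
    then show "emeasure (distr \<gamma> (density \<nu> v) snd) A = emeasure (density \<nu> v) A"
      by (simp add: g_snd emeasure_density)
  qed simp
  moreover have "prob_space \<gamma>"
    using g_fst[of "\<lambda>_. 1"] by (intro prob_spaceI) (simp add: u1)
  ultimately have coupling: "\<gamma> \<in> couplings (density \<mu> u) (density \<nu> v)"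
    by (simp add: couplings_def sets_g sets_N)
  \<comment> \<open>The paired part has mass \<open>R\<close>, and each unit of it costs at most
    \<open>D\<close>.\<close>
  have "(\<integral>\<^sup>+ p. \<integral>\<^sup>+ q. a p * b q / R * f (fst p, snd q) \<partial>\<pi> \<partial>\<pi>) \<le> (\<integral>\<^sup>+ p. \<integral>\<^sup>+ q. a p * (D / R) * b q \<partial>\<pi> \<partial>\<pi>)"
  proof (intro nn_integral_mono)
    fix p q
    have "a p * b q / R * f (fst p, snd q) \<le> a p * b q / R * D"
      by (intro mult_left_mono fD) simp
    then show "a p * b q / R * f (fst p, snd q) \<le> a p * (D / R) * b q"
      by (simp add: divide_ennreal_def mult_ac)
  qed
  also have "\<dots> = R * (D / R) * R"
    by (simp add: nn_integral_cmult nn_integral_multc Rb R_def[symmetric])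
  also have "\<dots> = D * (R * (R / R))"
    by (simp add: divide_ennreal_def mult_ac)
  \<comment> \<open>In \<open>ennreal\<close>, \<open>0 / 0 = 0\<close>, but the extra factor makes
    \<open>R * (R / R) = R\<close> hold for \<open>R = 0\<close> as well.\<close>
  also have "\<dots> = D * R"
    by (cases "R = 0") (simp_all add: R_R)
  finally have "(\<integral>\<^sup>+ z. f z \<partial>\<gamma>) \<le> (\<integral>\<^sup>+ z. w z * f z \<partial>\<pi>) + D * (1 - (\<integral>\<^sup>+ z. w z \<partial>\<pi>))"
    by (subst int_g) (simp_all add: R_eq[symmetric] add_left_mono)
  with coupling show ?thesis by blast
qed

section \<open>Both estimates for a fixed coupling of the priors\<close>

text \<open>The infimum over couplings is postponed. For a fixed \<open>\<pi>\<close> the distance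
  and the likelihood are bounded, hence integrable, so the main inequalities can be proved in the
  reals and then transferred to \<open>ennreal\<close>.\<close>

lemma bayes_coupling_bounds:
  fixes \<mu> \<mu>' :: "'a::polish_space measure" and \<Phi> :: "'a \<Rightarrow> real" and D :: real
  assumes D: "\<And>x y :: 'a. dist x y \<le> D"
    and Phi [measurable]: "\<Phi> \<in> borel_measurable borel"
    and Phi_nonneg: "\<And>x. 0 \<le> \<Phi> x"
    and Lip: "Lip (\<lambda>x. exp (- \<Phi> x)) < \<infinity>"
    and mu: "prob_space \<mu>" and sets_mu [measurable_cong]: "sets \<mu> = sets borel"
    and mu': "prob_space \<mu>'" and sets_mu' [measurable_cong]: "sets \<mu>' = sets borel"
    and pi: "\<pi> \<in> couplings \<mu> \<mu>'"
  shows "W1 (posterior \<Phi> \<mu>) (posterior \<Phi> \<mu>')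
      \<le> (1 + ennreal D * Lip (\<lambda>x. exp (- \<Phi> x))) / ennreal (norm_const \<Phi> \<mu>')
        * (\<integral>\<^sup>+ (x, y). ennreal (dist x y) \<partial>\<pi>)" (is ?cost)
    and "ennreal \<bar>norm_const \<Phi> \<mu> - norm_const \<Phi> \<mu>'\<bar>
      \<le> Lip (\<lambda>x. exp (- \<Phi> x)) * (\<integral>\<^sup>+ (x, y). ennreal (dist x y) \<partial>\<pi>)" (is ?const)
proof -
  from pi have sets_pi [measurable_cong]: "sets \<pi> = sets (\<mu> \<Otimes>\<^sub>M \<mu>')"
    and fst_pi: "distr \<pi> \<mu> fst = \<mu>" and snd_pi: "distr \<pi> \<mu>' snd = \<mu>'"
    and "prob_space \<pi>"
    by (auto simp: couplings_def)
  interpret P: prob_space \<pi> by fact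
  define g where "g x = exp (- \<Phi> x)" for x
  define L where "L = enn2real (Lip g)"
  define Z Z' where "Z = norm_const \<Phi> \<mu>" and "Z' = norm_const \<Phi> \<mu>'"
  define M where "M = max Z Z'"
  have [measurable]: "\<Phi> \<in> borel_measurable \<mu>" "\<Phi> \<in> borel_measurable \<mu>'"
    by measurable
  have [measurable]: "g \<in> borel_measurable borel"
    unfolding g_def by measurable
  have g01: "0 < g x" "g x \<le> 1" for x
    using Phi_nonneg by (auto simp: g_def)
  have gL: "\<bar>g x - g y\<bar> \<le> L * dist x y" for x y
    using abs_diff_le_Lip[of g] Lip unfolding L_def g_def by simp
  have L0: "0 \<le> L" by (simp add: L_def)
  have LipL: "Lip (\<lambda>x. exp (- \<Phi> x)) = ennreal L"
    using Lip by (simp add: L_def g_def[abs_def])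
  have D0: "0 \<le> D" using D[of undefined undefined] by simp
  have Zpos: "0 < Z" "0 < Z'"
    unfolding Z_def Z'_def using Phi_nonneg mu mu' by (auto intro!: norm_const_pos)
  have dist_meas [measurable]: "(\<lambda>z. dist (fst z) (snd z)) \<in> borel_measurable \<pi>"
    by measurable
  have gi1: "integrable \<pi> (\<lambda>z. g (fst z))"
    by (rule P.integrable_const_bound[where B = 1]) (use g01 in \<open>auto simp: less_imp_le\<close>)
  have gi2: "integrable \<pi> (\<lambda>z. g (snd z))"
    by (rule P.integrable_const_bound[where B = 1]) (use g01 in \<open>auto simp: less_imp_le\<close>)
  have di: "integrable \<pi> (\<lambda>z. dist (fst z) (snd z))"
    by (rule P.integrable_const_bound[where B = D]) (use D in auto)
  have Z_eq: "Z = (\<integral>z. g (fst z) \<partial>\<pi>)"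
    unfolding Z_def norm_const_def g_def[symmetric]
    by (subst fst_pi[symmetric], rule integral_distr) measurable
  have Z'_eq: "Z' = (\<integral>z. g (snd z) \<partial>\<pi>)"
    unfolding Z'_def norm_const_def g_def[symmetric]
    by (subst snd_pi[symmetric], rule integral_distr) measurable
  define W where "W = (\<integral>z. dist (fst z) (snd z) \<partial>\<pi>)"
  have W0: "0 \<le> W" by (simp add: W_def)
  have W_eq: "(\<integral>\<^sup>+ (x, y). ennreal (dist x y) \<partial>\<pi>) = ennreal W"
    unfolding W_def case_prod_beta by (rule nn_integral_eq_integral) (use di in auto)
  \<comment> \<open>Through the marginals of \<open>\<pi>\<close> both constants are integrals over
    the same space, where the Lipschitz bound applies pointwise.\<close>
  have "\<bar>Z - Z'\<bar> = \<bar>\<integral>z. g (fst z) - g (snd z) \<partial>\<pi>\<bar>"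
    unfolding Z_eq Z'_eq using gi1 gi2 by simp
  also have "\<dots> \<le> (\<integral>z. \<bar>g (fst z) - g (snd z)\<bar> \<partial>\<pi>)"
    by (rule integral_abs_bound)
  also have "\<dots> \<le> (\<integral>z. L * dist (fst z) (snd z) \<partial>\<pi>)"
    by (intro integral_mono) (use gi1 gi2 di gL in auto)
  also have "\<dots> = L * W"
    by (simp add: W_def)
  finally show ?const
    unfolding W_eq LipL Z_def[symmetric] Z'_def[symmetric] using L0 W0
    by (simp flip: ennreal_mult)

  have M: "Z \<le> M" "Z' \<le> M" "0 < M" using Zpos by (auto simp: M_def)
  \<comment> \<open>Dividing by the larger constant keeps \<open>w\<close> below both posterior
    densities \<open>g / Z\<close> and \<open>g / Z'\<close>.\<close>
  define w where "w z = min (g (fst z)) (g (snd z)) / M" for z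
  have [measurable]: "w \<in> borel_measurable \<pi>"
    unfolding w_def by measurable
  have w0: "0 \<le> w z" for z
    using g01 M by (simp add: w_def less_imp_le)
  have w_le: "w z \<le> 1 / M" for z
    using g01[of "fst z"] M by (auto simp: w_def min_le_iff_disj intro!: divide_right_mono)
  have w_fst: "w z \<le> g (fst z) / Z" and w_snd: "w z \<le> g (snd z) / Z'" for z
    using g01 M Zpos unfolding w_def by (auto intro!: frac_le simp: less_imp_le)
  have wi: "integrable \<pi> w"
    by (rule P.integrable_const_bound[where B = "1 / M"]) (use w0 w_le in auto)
  \<comment> \<open>\<open>M * w z\<close> is the smaller of two values of \<open>g\<close> that
    differ by at most \<open>L\<close> times the distance.\<close>
  have min_ge: "g (fst z) - L * dist (fst z) (snd z) \<le> M * w z"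
    "g (snd z) - L * dist (fst z) (snd z) \<le> M * w z" for z
    using gL[of "fst z" "snd z"] M L0 mult_nonneg_nonneg[OF L0 zero_le_dist[of "fst z" "snd z"]]
    by (auto simp: w_def min_def abs_if split: if_splits)
  have "(\<integral>z. g (fst z) - L * dist (fst z) (snd z) \<partial>\<pi>) \<le> (\<integral>z. M * w z \<partial>\<pi>)"
    "(\<integral>z. g (snd z) - L * dist (fst z) (snd z) \<partial>\<pi>) \<le> (\<integral>z. M * w z \<partial>\<pi>)"
    by (intro integral_mono; use gi1 gi2 di wi min_ge in auto)+
  \<comment> \<open>The two integrated bounds have left sides \<open>Z - L * W\<close> and
    \<open>Z' - L * W\<close>; the larger of them is \<open>M - L * W\<close>.\<close>
  then have "M - L * W \<le> M * (\<integral>z. w z \<partial>\<pi>)"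
    using gi1 gi2 di by (simp add: Z_eq[symmetric] Z'_eq[symmetric] W_def[symmetric] M_def)
  then have res: "1 - (\<integral>z. w z \<partial>\<pi>) \<le> L * W / M"
    using M by (simp add: field_simps)
  have post: "posterior \<Phi> \<nu> = density \<nu> (\<lambda>x. ennreal (g x / norm_const \<Phi> \<nu>))" for \<nu>
    by (simp add: posterior_def g_def)
  have post1: "(\<integral>\<^sup>+ x. ennreal (g x / norm_const \<Phi> \<nu>) \<partial>\<nu>) = 1"
    if "prob_space \<nu>" and [measurable_cong]: "sets \<nu> = sets borel" for \<nu> :: "'a measure"
  proof -
    have "\<Phi> \<in> borel_measurable \<nu>" by measurable
    with that(1) Phi_nonneg have "prob_space (posterior \<Phi> \<nu>)"
      by (intro prob_space_posterior)
    then have "emeasure (posterior \<Phi> \<nu>) (space (posterior \<Phi> \<nu>)) = 1"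
      by (rule prob_space.emeasure_space_1)
    then show ?thesis
      unfolding post by (simp add: emeasure_density cong: nn_integral_cong)
  qed
  \<comment> \<open>This is \<open>coupling_reweight\<close> with the posterior densities as
    \<open>u\<close> and \<open>v\<close> and the distance as the cost \<open>f\<close>.\<close>
  obtain \<gamma> where \<gamma>: "\<gamma> \<in> couplings (posterior \<Phi> \<mu>) (posterior \<Phi> \<mu>')"
    and le: "(\<integral>\<^sup>+ z. ennreal (dist (fst z) (snd z)) \<partial>\<gamma>)
      \<le> (\<integral>\<^sup>+ z. ennreal (w z) * ennreal (dist (fst z) (snd z)) \<partial>\<pi>)
        + ennreal D * (1 - (\<integral>\<^sup>+ z. ennreal (w z) \<partial>\<pi>))"
  proof -
    have "\<exists>\<gamma> \<in> couplings (posterior \<Phi> \<mu>) (posterior \<Phi> \<mu>').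
        (\<integral>\<^sup>+ z. ennreal (dist (fst z) (snd z)) \<partial>\<gamma>)
      \<le> (\<integral>\<^sup>+ z. ennreal (w z) * ennreal (dist (fst z) (snd z)) \<partial>\<pi>)
        + ennreal D * (1 - (\<integral>\<^sup>+ z. ennreal (w z) \<partial>\<pi>))"
      unfolding post Z_def[symmetric] Z'_def[symmetric]
      by (rule coupling_reweight[OF pi])
        (use post1[OF mu sets_mu] post1[OF mu' sets_mu'] in
          \<open>simp_all add: Z_def[symmetric] Z'_def[symmetric] D w_fst w_snd ennreal_leI\<close>)
    then show thesis using that by blast
  qed
  have "W1 (posterior \<Phi> \<mu>) (posterior \<Phi> \<mu>') \<le> (\<integral>\<^sup>+ z. ennreal (dist (fst z) (snd z)) \<partial>\<gamma>)"
    unfolding W1_def case_prod_beta by (rule INF_lower[OF \<gamma>])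
  also note le
  \<comment> \<open>As \<open>g\<close> is at most 1, \<open>w\<close> is at most
    \<open>1 / M\<close>.\<close>
  also have "(\<integral>\<^sup>+ z. ennreal (w z) * ennreal (dist (fst z) (snd z)) \<partial>\<pi>)
      \<le> (\<integral>\<^sup>+ z. ennreal (1 / M * dist (fst z) (snd z)) \<partial>\<pi>)"
    using w0 by (intro nn_integral_mono)
      (simp flip: ennreal_mult, intro ennreal_leI, use mult_right_mono[OF w_le zero_le_dist] in simp)
  also have "\<dots> = ennreal (1 / M * W)"
    using nn_integral_eq_integral[OF integrable_mult_right[OF di, of "1 / M"]] M
    by (simp add: W_def)
  also have "1 - (\<integral>\<^sup>+ z. ennreal (w z) \<partial>\<pi>) = ennreal (1 - (\<integral>z. w z \<partial>\<pi>))"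
    using nn_integral_eq_integral[OF wi] w0
    by (simp add: ennreal_minus integral_nonneg flip: ennreal_1)
  also have "ennreal (1 / M * W) + ennreal D * ennreal (1 - (\<integral>z. w z \<partial>\<pi>))
      \<le> ennreal (1 / M * W) + ennreal D * ennreal (L * W / M)"
    by (intro add_left_mono mult_left_mono ennreal_leI res) simp
  also have "\<dots> = ennreal ((1 + D * L) * W / M)"
    using M W0 D0 L0
    by (simp add: field_simps flip: ennreal_mult ennreal_plus)
  \<comment> \<open>The bound is symmetric in the two priors up to here; \<open>Z' \<le> M\<close>
    brings in the constant of the claim.\<close>
  also have "\<dots> \<le> ennreal ((1 + D * L) * W / Z')"
    using M W0 D0 L0 Zpos by (intro ennreal_leI divide_left_mono) auto
  also have "\<dots> = (1 + ennreal D * ennreal L) / ennreal Z' * ennreal W"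
    using W0 D0 L0 Zpos
    by (simp add: divide_ennreal flip: ennreal_mult ennreal_plus ennreal_1)
  finally show ?cost
    unfolding W_eq LipL Z'_def[symmetric] by (simp add: add_mono)
qed

section \<open>Passage to the infimum over couplings\<close>

theorem theorem15:
  fixes \<mu> \<mu>' :: "'a::polish_space measure"
    and \<Phi> :: "'a \<Rightarrow> real"
    and D :: real
  assumes "\<And>x y :: 'a. dist x y \<le> D"
    and "\<Phi> \<in> borel_measurable borel"
    and "\<And>x. 0 \<le> \<Phi> x"
    and "Lip (\<lambda>x. exp (- \<Phi> x)) < \<infinity>"
    and "prob_space \<mu>" and "sets \<mu> = sets borel"
    and "prob_space \<mu>'" and "sets \<mu>' = sets borel"
  shows "W1 (posterior \<Phi> \<mu>) (posterior \<Phi> \<mu>')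
      \<le> (1 + ennreal D * Lip (\<lambda>x. exp (- \<Phi> x))) / ennreal (norm_const \<Phi> \<mu>')
        * (1 + Lip (\<lambda>x. exp (- \<Phi> x)) * (first_moment \<mu> / ennreal (norm_const \<Phi> \<mu>)))
        * W1 \<mu> \<mu>'
    \<and> ennreal \<bar>norm_const \<Phi> \<mu> - norm_const \<Phi> \<mu>'\<bar>
      \<le> Lip (\<lambda>x. exp (- \<Phi> x)) * W1 \<mu> \<mu>'"
proof
  let ?L = "Lip (\<lambda>x. exp (- \<Phi> x))"
  let ?c = "(1 + ennreal D * ?L) / ennreal (norm_const \<Phi> \<mu>')"
  let ?m = "1 + ?L * (first_moment \<mu> / ennreal (norm_const \<Phi> \<mu>))"
  note bounds = bayes_coupling_bounds[OF assms]
  have "\<Phi> \<in> borel_measurable \<mu>'"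
    using assms(2) measurable_cong_sets[OF assms(8) refl] by blast
  then have "0 < norm_const \<Phi> \<mu>'"
    using assms(3,7) by (intro norm_const_pos)
  \<comment> \<open>Positivity of the denominator matters: dividing the positive numerator by 0
    would give \<open>\<top>\<close>.\<close>
  then have c: "?c \<noteq> \<top>"
    using assms(4) by (simp add: ennreal_divide_eq_top_iff ennreal_mult_eq_top_iff)
  have ne: "couplings \<mu> \<mu>' \<noteq> {}"
    using pair_measure_in_couplings[OF assms(5,7)] by blast
  \<comment> \<open>The left side does not depend on the coupling of the priors, so only
    \<open>W1 \<mu> \<mu>'\<close> is expanded as an infimum.\<close>
  have "W1 (posterior \<Phi> \<mu>) (posterior \<Phi> \<mu>') \<le> ?c * W1 \<mu> \<mu>'"
    unfolding W1_def[of \<mu>] by (rule ennreal_le_cmult_INF[OF ne c]) (rule bounds(1))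
  also have "\<dots> = ?c * 1 * W1 \<mu> \<mu>'"
    by simp
  also have "\<dots> \<le> ?c * ?m * W1 \<mu> \<mu>'"
    by (intro mult_right_mono mult_left_mono) auto
  finally show "W1 (posterior \<Phi> \<mu>) (posterior \<Phi> \<mu>') \<le> ?c * ?m * W1 \<mu> \<mu>'" .
  show "ennreal \<bar>norm_const \<Phi> \<mu> - norm_const \<Phi> \<mu>'\<bar> \<le> ?L * W1 \<mu> \<mu>'"
    unfolding W1_def by (rule ennreal_le_cmult_INF[OF ne]) (use assms(4) bounds(2) in auto)
qed

end
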